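(* There exist two nonisomorphic nonabelian groups of order $512$, each of which contains a partial difference set with parameters $(512,133,24,38)$.
   Context: Let $G$ be a finite group of order $v$. A $(v,k,\lambda,\mu)$ partial difference set (PDS) in $G$ is a subset $S\subseteq G$ with $|S|=k$, $1\notin S$, $S=\{s^{-1}:s\in S\}$, such that in the group ring $\mathbb{Z}[G]$ (identifying a subset with the sum of its elements) $S^2=k\cdot 1+\lambda S+\mu(G-S-1)$. Equivalently, every nonidentity element $g\in G$ can be written as $xy^{-1}$ with $x,y\in S$ in exactly $\lambda$ ways if $g\in S$ and in exactly $\mu$ ways if $g\notin S$. *)

theory Defs
  imports "HOL-Algebra.Algebra" "HOL-Library.Indicator_Function"
begin

text \<open>
  Elements of the integral group ring of a finite group \<open>G\<close> are represented by their coefficient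
  functions, which vanish outside \<open>carrier G\<close>. A subset \<open>A\<close> of the carrier, regarded as the sum of
  its elements, is \<open>indicator A\<close>; in particular \<open>\<one>\<^bsub>G\<^esub>\<close> is \<open>indicator {\<one>\<^bsub>G\<^esub>}\<close> and \<open>G\<close> itself is
  \<open>indicator (carrier G)\<close>. Addition and integer multiples are pointwise.
\<close>

definition group_ring_mult ::
    "('a, 'm) monoid_scheme \<Rightarrow> ('a \<Rightarrow> int) \<Rightarrow> ('a \<Rightarrow> int) \<Rightarrow> ('a \<Rightarrow> int)" where
  "group_ring_mult G a b =
     (\<lambda>g. \<Sum>(x, y) \<in> {(x, y). x \<in> carrier G \<and> y \<in> carrier G \<and> x \<otimes>\<^bsub>G\<^esub> y = g}. a x * b y)"

definition partial_difference_set ::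
    "('a, 'm) monoid_scheme \<Rightarrow> nat \<Rightarrow> nat \<Rightarrow> nat \<Rightarrow> nat \<Rightarrow> 'a set \<Rightarrow> bool" where
  "partial_difference_set G v k l m S \<longleftrightarrow>
     group G \<and> finite (carrier G) \<and> order G = v \<and>
     S \<subseteq> carrier G \<and> card S = k \<and> \<one>\<^bsub>G\<^esub> \<notin> S \<and> S = {inv\<^bsub>G\<^esub> s | s. s \<in> S} \<and>
     group_ring_mult G (indicator S) (indicator S) =
       (\<lambda>g. int k * indicator {\<one>\<^bsub>G\<^esub>} g + int l * indicator S g
            + int m * (indicator (carrier G) g - indicator S g - indicator {\<one>\<^bsub>G\<^esub>} g))"

end

theory Submission
  imports Defs "HOL-Library.Z2" "HOL-Library.Cardinality"
begin

text \<open>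
  Let \<open>F\<close> be a finite field of characteristic two with \<open>q\<close> elements, such that \<open>X\<^sup>2 + X + 1\<close> has no root
  in \<open>F\<close>, and let \<open>\<omega>\<close> be a root in the quadratic extension. Pairs \<open>(a, b)\<close> over the extension for
  which the trace of \<open>b\<close> is the norm of \<open>a\<close> form a nonabelian group of order \<open>q\<^sup>3\<close>, which acts regularly
  on the points of a Hermitian unital other than one fixed point. The nonidentity elements with
  \<open>b \<in> F \<union> F\<omega> \<union> F\<omega>\<^sup>2\<close> form a partial difference set in it, with \<open>k = q - 1 + 2(q\<^sup>2 - 1)\<close>, \<open>\<lambda> = 3q\<close>
  and \<open>\<mu> = 4q + 6\<close>. For \<open>q = 8\<close> these are the required parameters.

  The verification is plane geometry over \<open>F\<close>. For a noncentral \<open>g\<close> the factorizations of \<open>g\<close>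
  into two elements of the set are, up to a correction at two points, the points on two lines and two
  conics in the affine plane of all \<open>a\<close> (\<open>sum_hits\<close>). Lines have \<open>q\<close> points. The conics are norm
  equations \<open>N = c\<close>, with \<open>q + 1\<close> points, or a single point when they degenerate; exactly one of the
  two degenerates when \<open>g\<close> is in the set, and none otherwise. This produces the two different counts
  (\<open>card_quotients_noncentral\<close>).

  The second group comes from the field automorphism \<open>\<omega> \<mapsto> \<omega> + 1\<close>, an involution that preserves
  the set and hence acts on its Cayley graph. Composing left multiplication by half of the elements
  with this involution gives another regular group of automorphisms of the same graph, so the same set
  is again a partial difference set (\<open>partial_difference_set_twist\<close>). The first group has exponent
  four, whereas the second contains an element whose fourth power is nontrivial. Both are finally
  copied onto natural numbers.
\<close>

section \<open>Partial difference sets as quotient counts\<close>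

text \<open>
  A factorization \<open>x y = g\<close> is determined by \<open>x\<close>, so the coefficient at \<open>g\<close> is a count of elements
  of \<open>S\<close>. Transport along isomorphisms and twists is immediate for such counts, unlike for group
  ring identities.
\<close>
lemma group_ring_mult_indicator:
  assumes "group G" "finite (carrier G)" "S \<subseteq> carrier G" "g \<in> carrier G"
  shows "group_ring_mult G (indicator S) (indicator S) g
    = int (card {x \<in> S. inv\<^bsub>G\<^esub> x \<otimes>\<^bsub>G\<^esub> g \<in> S})"
proof -
  interpret group G by fact
  let ?P = "{(x, y). x \<in> carrier G \<and> y \<in> carrier G \<and> x \<otimes>\<^bsub>G\<^esub> y = g}"
  let ?D = "{x \<in> S. inv\<^bsub>G\<^esub> x \<otimes>\<^bsub>G\<^esub> g \<in> S}"
  have P: "?P = (\<lambda>x. (x, inv\<^bsub>G\<^esub> x \<otimes>\<^bsub>G\<^esub> g)) ` carrier G"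
    using assms(4) by (auto simp: inv_solve_left m_assoc[symmetric] image_iff)
  have "group_ring_mult G (indicator S) (indicator S) g
      = (\<Sum>x\<in>carrier G. indicator S x * indicator S (inv\<^bsub>G\<^esub> x \<otimes>\<^bsub>G\<^esub> g))"
    unfolding group_ring_mult_def P by (subst sum.reindex) (auto simp: inj_on_def)
  also have "\<dots> = (\<Sum>x\<in>carrier G. of_bool (x \<in> S \<and> inv\<^bsub>G\<^esub> x \<otimes>\<^bsub>G\<^esub> g \<in> S))"
    by (intro sum.cong) (auto simp: indicator_def)
  also have "\<dots> = int (card ?D)"
    using assms(2,3) by (auto simp: sum_of_bool_eq intro!: arg_cong[where f = card])
  finally show ?thesis .
qed

text \<open>
  The group ring equation has content only at nonidentity elements of the group: outside the
  carrier both sides vanish, and at the identity both sides are \<open>k\<close> because \<open>S\<close> is closed under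
  inverses.
\<close>
lemma partial_difference_set_iff:
  "partial_difference_set G v k l m S \<longleftrightarrow>
     group G \<and> finite (carrier G) \<and> order G = v \<and> S \<subseteq> carrier G \<and> card S = k \<and>
     \<one>\<^bsub>G\<^esub> \<notin> S \<and> (\<forall>s\<in>S. inv\<^bsub>G\<^esub> s \<in> S) \<and>
     (\<forall>g\<in>carrier G - {\<one>\<^bsub>G\<^esub>}. card {x \<in> S. inv\<^bsub>G\<^esub> x \<otimes>\<^bsub>G\<^esub> g \<in> S} = (if g \<in> S then l else m))"
proof (cases "group G \<and> finite (carrier G) \<and> order G = v \<and> S \<subseteq> carrier G \<and> card S = k
    \<and> \<one>\<^bsub>G\<^esub> \<notin> S")
  case True
  then interpret group G by blast
  have SG: "\<And>s. s \<in> S \<Longrightarrow> s \<in> carrier G" and S1: "\<one>\<^bsub>G\<^esub> \<notin> S"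
    using True by auto
  have symm: "S = {inv\<^bsub>G\<^esub> s | s. s \<in> S} \<longleftrightarrow> (\<forall>s\<in>S. inv\<^bsub>G\<^esub> s \<in> S)"
  proof
    assume *: "\<forall>s\<in>S. inv\<^bsub>G\<^esub> s \<in> S"
    have "s = inv\<^bsub>G\<^esub> (inv\<^bsub>G\<^esub> s)" if "s \<in> S" for s using SG that by simp
    with * show "S = {inv\<^bsub>G\<^esub> s | s. s \<in> S}" by blast
  qed blast
  let ?f = "group_ring_mult G (indicator S) (indicator S)"
  let ?h = "\<lambda>g. int k * indicator {\<one>\<^bsub>G\<^esub>} g + int l * indicator S g
    + int m * (indicator (carrier G) g - indicator S g - indicator {\<one>\<^bsub>G\<^esub>} g)"
  have f: "?f g = int (card {x \<in> S. inv\<^bsub>G\<^esub> x \<otimes>\<^bsub>G\<^esub> g \<in> S})" if "g \<in> carrier G" for g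
    using group_ring_mult_indicator[of G S g] True that by blast
  have outside: "?f g = ?h g" if "g \<notin> carrier G" for g
  proof -
    have "{(x, y). x \<in> carrier G \<and> y \<in> carrier G \<and> x \<otimes>\<^bsub>G\<^esub> y = g} = {}" using that by auto
    then have "?f g = 0" by (simp only: group_ring_mult_def sum.empty)
    moreover have "g \<notin> S" "g \<noteq> \<one>\<^bsub>G\<^esub>" using that SG by auto
    ultimately show ?thesis using that by simp
  qed
  have at_one: "?f \<one>\<^bsub>G\<^esub> = ?h \<one>\<^bsub>G\<^esub>" if "\<forall>s\<in>S. inv\<^bsub>G\<^esub> s \<in> S"
  proof -
    have "{x \<in> S. inv\<^bsub>G\<^esub> x \<otimes>\<^bsub>G\<^esub> \<one>\<^bsub>G\<^esub> \<in> S} = S" using that SG by auto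
    then show ?thesis using f[of "\<one>\<^bsub>G\<^esub>"] S1 True by simp
  qed
  have inside: "?f g = ?h g \<longleftrightarrow>
      card {x \<in> S. inv\<^bsub>G\<^esub> x \<otimes>\<^bsub>G\<^esub> g \<in> S} = (if g \<in> S then l else m)"
    if "g \<in> carrier G - {\<one>\<^bsub>G\<^esub>}" for g
    using f[of g] that by (auto simp: indicator_def)
  have "?f = ?h \<longleftrightarrow> (\<forall>g\<in>carrier G - {\<one>\<^bsub>G\<^esub>}. ?f g = ?h g)" if "\<forall>s\<in>S. inv\<^bsub>G\<^esub> s \<in> S"
    unfolding fun_eq_iff using outside at_one[OF that] by blast
  then have "?f = ?h \<longleftrightarrow> (\<forall>g\<in>carrier G - {\<one>\<^bsub>G\<^esub>}.
      card {x \<in> S. inv\<^bsub>G\<^esub> x \<otimes>\<^bsub>G\<^esub> g \<in> S} = (if g \<in> S then l else m))" if "\<forall>s\<in>S. inv\<^bsub>G\<^esub> s \<in> S"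
    using inside that by simp
  then show ?thesis
    unfolding partial_difference_set_def symm using True by blast
next
  case False
  then show ?thesis unfolding partial_difference_set_def by blast
qed

lemma partial_difference_set_iso:
  assumes S: "partial_difference_set G v k l m S" and H: "group H" and f: "f \<in> iso G H"
  shows "partial_difference_set H v k l m (f ` S)"
proof -
  have G: "group G" "finite (carrier G)" "order G = v" "S \<subseteq> carrier G" "card S = k"
      "\<one>\<^bsub>G\<^esub> \<notin> S" "\<And>s. s \<in> S \<Longrightarrow> inv\<^bsub>G\<^esub> s \<in> S"
    and count: "\<And>g. g \<in> carrier G - {\<one>\<^bsub>G\<^esub>} \<Longrightarrow>
      card {x \<in> S. inv\<^bsub>G\<^esub> x \<otimes>\<^bsub>G\<^esub> g \<in> S} = (if g \<in> S then l else m)"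
    using S by (auto simp: partial_difference_set_iff)
  interpret G: group G by fact
  interpret H: group H by fact
  interpret h: group_hom G H f
    using f by unfold_locales (auto simp: iso_def)
  have inj: "inj_on f (carrier G)" and onto: "f ` carrier G = carrier H"
    using f by (auto simp: iso_def bij_betw_def)
  have injS: "inj_on f A" if "A \<subseteq> S" for A
    using inj_on_subset[OF inj] that G(4) by blast
  have mem: "f x \<in> f ` S \<longleftrightarrow> x \<in> S" if "x \<in> carrier G" for x
    using inj_on_image_mem_iff[OF inj that G(4)] .
  have "card {y \<in> f ` S. inv\<^bsub>H\<^esub> y \<otimes>\<^bsub>H\<^esub> g' \<in> f ` S} = (if g' \<in> f ` S then l else m)"
    if g': "g' \<in> carrier H - {\<one>\<^bsub>H\<^esub>}" for g'
  proof -
    obtain g where g: "g \<in> carrier G" "g' = f g" using g' onto by blast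
    have "inv\<^bsub>H\<^esub> (f x) \<otimes>\<^bsub>H\<^esub> f g \<in> f ` S \<longleftrightarrow> inv\<^bsub>G\<^esub> x \<otimes>\<^bsub>G\<^esub> g \<in> S" if "x \<in> S" for x
    proof -
      have "x \<in> carrier G" using that G(4) by blast
      then show ?thesis using g mem[of "inv\<^bsub>G\<^esub> x \<otimes>\<^bsub>G\<^esub> g"] by simp
    qed
    then have "{y \<in> f ` S. inv\<^bsub>H\<^esub> y \<otimes>\<^bsub>H\<^esub> g' \<in> f ` S} = f ` {x \<in> S. inv\<^bsub>G\<^esub> x \<otimes>\<^bsub>G\<^esub> g \<in> S}"
      using g by auto
    moreover have "g \<in> carrier G - {\<one>\<^bsub>G\<^esub>}" using g g' by auto
    ultimately show ?thesis
      using count[of g] mem[of g] g injS by (simp add: card_image)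
  qed
  moreover have "card (f ` S) = k" using G(5) injS by (simp add: card_image)
  moreover have "order H = v" using G(3) inj onto unfolding order_def by (metis card_image)
  moreover have "inv\<^bsub>H\<^esub> y \<in> f ` S" if y: "y \<in> f ` S" for y
  proof -
    obtain x where x: "x \<in> S" "y = f x" using y by blast
    then have "f (inv\<^bsub>G\<^esub> x) = inv\<^bsub>H\<^esub> y" using G(4) by (metis h.hom_inv subsetD)
    then show ?thesis using G(7)[OF x(1)] by (metis image_eqI)
  qed
  moreover have "\<one>\<^bsub>H\<^esub> \<notin> f ` S" using mem[of "\<one>\<^bsub>G\<^esub>"] G(6) by simp
  moreover have "f ` S \<subseteq> carrier H" "finite (carrier H)"
    using G(2,4) onto[symmetric] by auto
  ultimately show ?thesis using H unfolding partial_difference_set_iff by blast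
qed

section \<open>Twisting a group by automorphisms\<close>

text \<open>
  When \<open>\<phi>\<close> takes values in the automorphisms of \<open>G\<close> and \<open>\<phi> (x \<otimes> \<phi> x y) = \<phi> x \<circ> \<phi> y\<close>, the maps
  \<open>y \<mapsto> x \<otimes> \<phi> x y\<close> form a group of permutations that is regular on the carrier of \<open>G\<close>, and the
  twist is this group with its elements labelled by the images of the identity. (The two
  multiplications together form a skew brace.)
\<close>
definition twist :: "('a, 'm) monoid_scheme \<Rightarrow> ('a \<Rightarrow> 'a \<Rightarrow> 'a) \<Rightarrow> 'a monoid" where
  "twist G \<phi> = \<lparr>carrier = carrier G, monoid.mult = (\<lambda>x y. x \<otimes>\<^bsub>G\<^esub> \<phi> x y), one = \<one>\<^bsub>G\<^esub>\<rparr>"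

lemma twist_simps [simp]:
  "carrier (twist G \<phi>) = carrier G" "x \<otimes>\<^bsub>twist G \<phi>\<^esub> y = x \<otimes>\<^bsub>G\<^esub> \<phi> x y"
  "\<one>\<^bsub>twist G \<phi>\<^esub> = \<one>\<^bsub>G\<^esub>"
  by (simp_all add: twist_def)

locale twisting = group G for G (structure) +
  fixes \<phi> :: "'a \<Rightarrow> 'a \<Rightarrow> 'a"
  assumes automorphism: "x \<in> carrier G \<Longrightarrow> \<phi> x \<in> iso G G"
    and twisted_hom: "x \<in> carrier G \<Longrightarrow> y \<in> carrier G \<Longrightarrow> z \<in> carrier G \<Longrightarrow>
      \<phi> (x \<otimes> \<phi> x y) z = \<phi> x (\<phi> y z)"
begin

lemma closed [simp]: "x \<in> carrier G \<Longrightarrow> y \<in> carrier G \<Longrightarrow> \<phi> x y \<in> carrier G"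
  using automorphism[of x] by (auto simp: iso_def hom_def)

lemma mult [simp]: "x \<in> carrier G \<Longrightarrow> y \<in> carrier G \<Longrightarrow> z \<in> carrier G \<Longrightarrow>
    \<phi> x (y \<otimes> z) = \<phi> x y \<otimes> \<phi> x z"
  using automorphism[of x] by (simp add: iso_def hom_def)

lemma one [simp]: "x \<in> carrier G \<Longrightarrow> \<phi> x \<one> = \<one>"
  using automorphism[of x] by (simp add: iso_def hom_one)

lemma inj: "x \<in> carrier G \<Longrightarrow> inj_on (\<phi> x) (carrier G)"
  using automorphism[of x] by (simp add: iso_def bij_betw_def)

lemma surj: "x \<in> carrier G \<Longrightarrow> y \<in> carrier G \<Longrightarrow> \<exists>z\<in>carrier G. \<phi> x z = y"
  using automorphism[of x] unfolding iso_def bij_betw_def by (metis (mono_tags, lifting) imageE mem_Collect_eq)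

lemma at_one [simp]:
  assumes "z \<in> carrier G" shows "\<phi> \<one> z = z"
proof -
  have "\<phi> \<one> (\<phi> \<one> z) = \<phi> \<one> z" using twisted_hom[of \<one> \<one> z] assms by simp
  then show ?thesis using inj[of \<one>] assms by (simp add: inj_on_eq_iff)
qed

lemma ex_right_inverse:
  assumes "x \<in> carrier G" shows "\<exists>y\<in>carrier G. x \<otimes> \<phi> x y = \<one>"
proof -
  obtain y where "y \<in> carrier G" "\<phi> x y = inv x" using surj[of x "inv x"] assms by auto
  then show ?thesis using assms by (metis r_inv)
qed

text \<open>
  Both sides expand to \<open>x \<otimes> \<phi> x y \<otimes> \<phi> x (\<phi> y z)\<close>; this is where the compatibility condition on
  \<open>\<phi>\<close> comes from.
\<close>
lemma twist_assoc:
  assumes x: "x \<in> carrier G" and y: "y \<in> carrier G" and z: "z \<in> carrier G"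
  shows "(x \<otimes> \<phi> x y) \<otimes> \<phi> (x \<otimes> \<phi> x y) z = x \<otimes> \<phi> x (y \<otimes> \<phi> y z)"
  unfolding twisted_hom[OF x y z] mult[OF x y closed[OF y z]]
  by (intro m_assoc closed x y z)

lemma group_twist: "group (twist G \<phi>)"
proof (rule groupI)
  fix x assume "x \<in> carrier (twist G \<phi>)"
  then have x: "x \<in> carrier G" by simp
  obtain y where y: "y \<in> carrier G" "x \<otimes> \<phi> x y = \<one>" using ex_right_inverse[OF x] by blast
  obtain z where z: "z \<in> carrier G" "y \<otimes> \<phi> y z = \<one>" using ex_right_inverse[OF y(1)] by blast
  \<comment> \<open>a right inverse of a right inverse of an element is the element itself\<close>
  have "x = z" using twist_assoc[OF x y(1) z(1)] x z(1) unfolding y(2) z(2) by simp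
  with y(1) z(2) show "\<exists>y\<in>carrier (twist G \<phi>). y \<otimes>\<^bsub>twist G \<phi>\<^esub> x = \<one>\<^bsub>twist G \<phi>\<^esub>"
    unfolding twist_simps by blast
next
  fix x y z
  show "x \<otimes>\<^bsub>twist G \<phi>\<^esub> y \<otimes>\<^bsub>twist G \<phi>\<^esub> z = x \<otimes>\<^bsub>twist G \<phi>\<^esub> (y \<otimes>\<^bsub>twist G \<phi>\<^esub> z)"
    if "x \<in> carrier (twist G \<phi>)" "y \<in> carrier (twist G \<phi>)" "z \<in> carrier (twist G \<phi>)"
    using that twist_assoc unfolding twist_simps by blast
next
  show "\<one>\<^bsub>twist G \<phi>\<^esub> \<otimes>\<^bsub>twist G \<phi>\<^esub> x = x" if "x \<in> carrier (twist G \<phi>)" for x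
    using that unfolding twist_simps by (simp only: at_one l_one)
  show "x \<otimes>\<^bsub>twist G \<phi>\<^esub> y \<in> carrier (twist G \<phi>)"
    if "x \<in> carrier (twist G \<phi>)" "y \<in> carrier (twist G \<phi>)" for x y
    using that closed unfolding twist_simps by blast
  show "\<one>\<^bsub>twist G \<phi>\<^esub> \<in> carrier (twist G \<phi>)" by simp
qed

text \<open>
  Left division of \<open>g\<close> by \<open>x\<close> in the twist is left division in \<open>G\<close> followed by the inverse of the
  automorphism \<open>\<phi> x\<close>. If all these automorphisms preserve \<open>S\<close>, then both groups have literally the
  same pairs with quotient in \<open>S\<close>: their Cayley graphs with connection set \<open>S\<close> coincide.
\<close>
lemma partial_difference_set_twist:
  assumes S: "partial_difference_set G v k l m S"
    and invariant: "\<And>x s. x \<in> carrier G \<Longrightarrow> s \<in> carrier G \<Longrightarrow> \<phi> x s \<in> S \<longleftrightarrow> s \<in> S"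
  shows "partial_difference_set (twist G \<phi>) v k l m S"
proof -
  interpret T: group "twist G \<phi>" by (rule group_twist)
  have SG: "S \<subseteq> carrier G" using S by (simp add: partial_difference_set_iff)
  have "inv\<^bsub>twist G \<phi>\<^esub> x \<otimes>\<^bsub>twist G \<phi>\<^esub> g \<in> S \<longleftrightarrow> inv x \<otimes> g \<in> S"
    if x: "x \<in> carrier G" and g: "g \<in> carrier G" for x g
  proof -
    define d where "d = inv\<^bsub>twist G \<phi>\<^esub> x \<otimes>\<^bsub>twist G \<phi>\<^esub> g"
    have d: "d \<in> carrier G" using T.m_closed[of "inv\<^bsub>twist G \<phi>\<^esub> x" g] T.inv_closed[of x] x g
      unfolding d_def by simp
    have "x \<otimes>\<^bsub>twist G \<phi>\<^esub> d = g"
      unfolding d_def using T.m_assoc[of x "inv\<^bsub>twist G \<phi>\<^esub> x" g] T.inv_closed[of x] T.r_inv[of x]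
        T.l_one[of g] x g by (simp only: twist_simps(1,3))
    then have "x \<otimes> \<phi> x d = g" by simp
    then have "\<phi> x d = inv x \<otimes> g" using x d g by (simp add: inv_solve_left)
    then show ?thesis using invariant[OF x d] unfolding d_def by simp
  qed
  note quotient = this
  have "inv\<^bsub>twist G \<phi>\<^esub> s \<in> S" if s: "s \<in> S" for s
  proof -
    have "s \<in> carrier G" using SG s by blast
    moreover from this have "inv\<^bsub>twist G \<phi>\<^esub> s \<otimes>\<^bsub>twist G \<phi>\<^esub> \<one> = inv\<^bsub>twist G \<phi>\<^esub> s"
      using T.r_one[OF T.inv_closed[of s]] by (simp del: twist_simps(2))
    ultimately show ?thesis
      using quotient[of s \<one>] S s by (simp add: partial_difference_set_iff del: twist_simps(2))
  qed
  moreover have "{x \<in> S. inv\<^bsub>twist G \<phi>\<^esub> x \<otimes>\<^bsub>twist G \<phi>\<^esub> g \<in> S} = {x \<in> S. inv x \<otimes> g \<in> S}"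
    if "g \<in> carrier G" for g
    using quotient SG that by blast
  ultimately show ?thesis
    using S group_twist by (simp add: partial_difference_set_iff order_def)
qed

end

section \<open>Norms from a quadratic extension in characteristic two\<close>

text \<open>
  Throughout, \<open>(x, y)\<close> stands for the element \<open>x + y\<omega>\<close> of a quadratic extension, where
  \<open>\<omega>\<^sup>2 = \<omega> + 1\<close>, in characteristic two. This is its norm.
\<close>
definition nrm :: "'a::field \<Rightarrow> 'a \<Rightarrow> 'a" where
  "nrm x y = x * x + x * y + y * y"

text \<open>
  Writing \<open>a = x + y\<omega>\<close>, \<open>a' = x' + y'\<omega>\<close> and conjugating by \<open>\<omega> \<mapsto> \<omega> + 1\<close>, the product of the
  conjugate of \<open>a\<close> with \<open>a'\<close> has this constant coefficient.
\<close>
definition cocycle :: "'a::field \<Rightarrow> 'a \<Rightarrow> 'a \<Rightarrow> 'a \<Rightarrow> 'a" where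
  "cocycle x y x' y' = x * x' + x' * y + y * y'"

text \<open>
  The pairs \<open>(a, b)\<close> over the quadratic extension for which the trace of \<open>b\<close> equals the norm of
  \<open>a\<close>, with \<open>(a, b) (a', b') = (a + a', b + b' + conj a * a')\<close>. The trace condition forces
  \<open>b = u + nrm x y * \<omega>\<close>, so the third coordinate \<open>u\<close> suffices. For a finite field with \<open>q\<close> elements
  that does not contain \<open>\<omega>\<close>, this is a Sylow subgroup of the unitary group in dimension three; it acts regularly on the \<open>q\<^sup>3\<close>
  points of the Hermitian unital other than the one it fixes.
\<close>
definition norm_group :: "('a::field \<times> 'a \<times> 'a) monoid" where
  "norm_group = \<lparr>carrier = UNIV,
     monoid.mult = (\<lambda>(x, y, u) (x', y', u'). (x + x', y + y', u + u' + cocycle x y x' y')),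
     one = (0, 0, 0)\<rparr>"

text \<open>
  If \<open>\<omega>\<close> is not in the base field then, in the notation \<open>(a, b)\<close>, these are the nonidentity elements
  for which \<open>b\<close> is a base field multiple of a cube root of unity: the three alternatives put \<open>b\<close> on the lines of \<open>1\<close>, \<open>\<omega>\<close> and
  \<open>\<omega>\<^sup>2\<close>.
\<close>
definition norm_set :: "('a::field \<times> 'a \<times> 'a) set" where
  "norm_set = {(x, y, u). (x, y, u) \<noteq> (0, 0, 0) \<and> (x = 0 \<and> y = 0 \<or> u = 0 \<or> u = nrm x y)}"

lemma norm_group_simps [simp]:
  "carrier norm_group = UNIV"
  "(x, y, u) \<otimes>\<^bsub>norm_group\<^esub> (x', y', u') = (x + x', y + y', u + u' + cocycle x y x' y')"
  "\<one>\<^bsub>norm_group\<^esub> = (0, 0, 0)"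
  by (simp_all add: norm_group_def)

lemma mem_norm_set:
  "(x, y, u) \<in> norm_set \<longleftrightarrow>
    (x, y, u) \<noteq> (0, 0, 0) \<and> (x = 0 \<and> y = 0 \<or> u = 0 \<or> u = nrm x y)"
  by (simp add: norm_set_def)

lemma card_triples:
  fixes P :: "'a::finite \<Rightarrow> 'a \<Rightarrow> 'a \<Rightarrow> bool"
  shows "card {(x, y, u). P x y u} = (\<Sum>(x, y)\<in>UNIV. card {u. P x y u})"
proof -
  have "bij_betw (\<lambda>((x, y), u). (x, y, u))
      (SIGMA z:UNIV. {u. P (fst z) (snd z) u}) {(x, y, u). P x y u}"
    by (auto simp: bij_betw_def inj_on_def image_iff)
  then have "card {(x, y, u). P x y u} = card (SIGMA z:UNIV. {u. P (fst z) (snd z) u})"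
    using bij_betw_same_card by fastforce
  then show ?thesis by (simp add: case_prod_unfold)
qed

text \<open>
  The second assumption makes the polynomial defining \<open>\<omega>\<close> irreducible. Finite fields of this kind
  are those with \<open>q = 2\<^sup>m\<close> elements, \<open>m\<close> odd.
\<close>
locale anisotropic_char2 =
  fixes T :: "'a::{field, finite} itself"
  assumes char2: "(1::'a) + 1 = 0"
    and no_root: "x * x + x + 1 \<noteq> (0::'a)"
begin

lemma add_self [simp]: "x + x = (0::'a)"
proof -
  have "x + x = x * (1 + 1)" by (simp only: distrib_left mult_1_right)
  then show ?thesis by (simp only: char2 mult_zero_right)
qed

lemma add_self_left [simp]: "x + (x + y) = (y::'a)"
  by (simp add: add.assoc[symmetric])

lemma eq_iff_add: "x = y \<longleftrightarrow> x + y = (0::'a)"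
  by (metis add_self add_self_left add.right_neutral)

text \<open>
  Equations are compared by moving everything to one side, where the simplifier can cancel equal
  summands in pairs.
\<close>
lemma eq_transfer: "a + b = c + d \<Longrightarrow> a = b \<longleftrightarrow> c = (d::'a)"
  by (metis eq_iff_add)

lemma nrm_zero [simp]: "nrm 0 0 = (0::'a)" by (simp add: nrm_def)

lemma nrm_eq_0 [simp]: "nrm x y = 0 \<longleftrightarrow> x = 0 \<and> y = (0::'a)"
proof (cases "y = 0")
  case False
  have "nrm x y = (x / y * (x / y) + x / y + 1) * (y * y)"
    using False by (simp add: nrm_def field_simps)
  then show ?thesis using no_root[of "x / y"] False by simp
qed (simp add: nrm_def)

lemma ex_sqrt: "\<exists>t. t * t = (c::'a)"
proof -
  have "inj (\<lambda>t::'a. t * t)"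
  proof (rule injI)
    fix s t :: 'a assume "s * s = t * t"
    then have "(s + t) * (s + t) = 0" by (simp add: algebra_simps)
    then show "s = t" by (simp add: eq_iff_add[of s t])
  qed
  then have "surj (\<lambda>t::'a. t * t)" by (simp add: finite_UNIV_inj_surj)
  then show ?thesis by (metis surjD)
qed

lemma card_ge_2: "CARD('a) \<ge> 2"
proof -
  have "card {0, 1::'a} \<le> CARD('a)" by (rule card_mono) auto
  then show ?thesis by simp
qed

text \<open>
  Every scalar is a square, so scaling carries the solutions for \<open>c = 1\<close> to those for any nonzero
  \<open>c\<close>. The \<open>q\<^sup>2 - 1\<close> nonzero vectors therefore split into \<open>q - 1\<close> classes of equal size.
\<close>
lemma card_nrm:
  assumes "c \<noteq> (0::'a)"
  shows "card {(x, y). nrm x y = c} = CARD('a) + 1"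
proof -
  let ?L = "\<lambda>c::'a. {(x, y). nrm x y = c}"
  have same: "card (?L c) = card (?L 1)" if "c \<noteq> 0" for c
  proof -
    obtain t where t: "t * t = c" using ex_sqrt by blast
    with that have t0: "t \<noteq> 0" by auto
    have scale: "nrm (t * x) (t * y) = c * nrm x y" for x y
      by (simp add: nrm_def t[symmetric] algebra_simps)
    have "bij_betw (\<lambda>(x, y). (t * x, t * y)) (?L 1) (?L c)"
    proof (rule bij_betw_byWitness[where f' = "\<lambda>(x, y). (x / t, y / t)"])
      show "(\<lambda>(x, y). (x / t, y / t)) ` ?L c \<subseteq> ?L 1"
      proof clarify
        fix x y assume c: "c = nrm x y"
        have "c * nrm (x / t) (y / t) = c * 1" using scale[of "x / t" "y / t"] t0 c by simp
        then show "nrm (x / t) (y / t) = 1" using that by (simp only: mult_cancel_left) simp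
      qed
    qed (auto simp: t0 scale)
    then show ?thesis by (rule bij_betw_same_card[symmetric])
  qed
  have "CARD('a \<times> 'a) = card (\<Union>c\<in>UNIV. ?L c)" by (rule arg_cong[where f = card]) auto
  also have "\<dots> = (\<Sum>c\<in>UNIV. card (?L c))" by (rule card_UN_disjoint) auto
  also have "\<dots> = card (?L 0) + (\<Sum>c\<in>UNIV - {0}. card (?L c))" by (rule sum.remove) auto
  also have "(\<Sum>c\<in>UNIV - {0}. card (?L c)) = (\<Sum>c\<in>UNIV - {0::'a}. card (?L 1))"
    by (intro sum.cong refl same) simp
  also have "\<dots> = (CARD('a) - 1) * card (?L 1)"
    by (simp add: card_Diff_singleton)
  also have "?L 0 = {(0, 0)}" by auto
  finally have "CARD('a) * CARD('a) = 1 + (CARD('a) - 1) * card (?L 1)"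
    by (simp add: card_cartesian_product flip: UNIV_Times_UNIV)
  moreover obtain n where n: "CARD('a) = n + 2" using card_ge_2 by (metis add.commute le_Suc_ex)
  ultimately have "(n + 2) * (n + 2) = 1 + (n + 2 - 1) * card (?L 1)" by (simp only:)
  then have "(n + 1) * card (?L 1) = (n + 1) * (n + 3)" by (simp add: algebra_simps)
  then have "card (?L 1) = n + 3" by (simp only: mult_cancel1) simp
  then show ?thesis using same[OF assms] n by simp
qed

lemma card_nrm_shift:
  "card {(x, y). nrm (x + a) (y + b) = (c::'a)} = (if c = 0 then 1 else CARD('a) + 1)"
proof -
  have "bij_betw (\<lambda>(x, y). (x + a, y + b)) {(x, y). nrm (x + a) (y + b) = c} {(x, y). nrm x y = c}"
    by (rule bij_betw_byWitness[where f' = "\<lambda>(x, y). (x + a, y + b)"]) (auto simp: add.assoc)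
  then have "card {(x, y). nrm (x + a) (y + b) = c} = card {(x, y). nrm x y = c}"
    by (rule bij_betw_same_card)
  moreover have "{(x, y). nrm x y = (0::'a)} = {(0, 0)}" by auto
  ultimately show ?thesis using card_nrm[of c] by (cases "c = 0") simp_all
qed

lemma card_line:
  assumes "(a, b) \<noteq> (0, 0::'a)"
  shows "card {(x, y). a * x + b * y = c} = CARD('a)"
proof (cases "b = 0")
  case True
  then have "{(x, y). a * x + b * y = c} = {c / a} \<times> UNIV" using assms by (auto simp: field_simps)
  then show ?thesis by (simp add: card_cartesian_product)
next
  case False
  then have "{(x, y). a * x + b * y = c} = range (\<lambda>x. (x, (c - a * x) / b))"
    by (auto simp: image_iff field_simps)
  then show ?thesis by (simp add: card_image inj_on_def)
qed

section \<open>The Hermitian group\<close>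

lemma group_norm_group: "group (norm_group :: ('a \<times> 'a \<times> 'a) monoid)"
proof (rule groupI)
  fix g :: "'a \<times> 'a \<times> 'a"
  obtain x y u where g: "g = (x, y, u)" by (metis prod_cases3)
  have "(x, y, u + nrm x y) \<otimes>\<^bsub>norm_group\<^esub> g = \<one>\<^bsub>norm_group\<^esub>"
    by (simp add: g cocycle_def nrm_def algebra_simps)
  then show "\<exists>h\<in>carrier norm_group. h \<otimes>\<^bsub>norm_group\<^esub> g = \<one>\<^bsub>norm_group\<^esub>" by auto
qed (auto simp: cocycle_def algebra_simps)

lemma inv_norm_group: "inv\<^bsub>norm_group\<^esub> (x, y, u) = (x, y, u + nrm x (y::'a))"
  by (rule group.inv_equality[OF group_norm_group]) (simp_all add: cocycle_def nrm_def algebra_simps)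

lemma order_norm_group: "order (norm_group :: ('a \<times> 'a \<times> 'a) monoid) = CARD('a) ^ 3"
  by (simp add: order_def card_cartesian_product power3_eq_cube flip: UNIV_Times_UNIV)

lemma card_norm_set: "card (norm_set :: ('a \<times> 'a \<times> 'a) set) = CARD('a) - 1 + 2 * (CARD('a) ^ 2 - 1)"
proof -
  have fibre: "card {u. (x, y, u) \<in> norm_set} = (if (x, y) = (0, 0) then CARD('a) - 1 else 2)"
    for x y :: 'a
  proof (cases "(x, y) = (0, 0)")
    case True
    then have "{u. (x, y, u) \<in> norm_set} = UNIV - {0}" by (auto simp: mem_norm_set)
    then show ?thesis using True by (simp add: card_Diff_singleton)
  next
    case False
    then have "{u. (x, y, u) \<in> norm_set} = {0, nrm x y}" and "nrm x y \<noteq> 0"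
      by (auto simp: mem_norm_set)
    then show ?thesis using False by auto
  qed
  have "card (norm_set :: ('a \<times> 'a \<times> 'a) set) = card {(x, y, u). (x, y, u) \<in> (norm_set :: ('a \<times> 'a \<times> 'a) set)}"
    by (rule arg_cong[where f = card]) auto
  also have "\<dots> = (\<Sum>(x, y)\<in>UNIV. card {u. (x, y, u) \<in> (norm_set :: ('a \<times> 'a \<times> 'a) set)})"
    by (rule card_triples)
  also have "\<dots> = (\<Sum>z\<in>(UNIV :: ('a \<times> 'a) set). if z = (0, 0) then CARD('a) - 1 else 2)"
    by (intro sum.cong) (simp_all add: fibre case_prod_unfold prod_eq_iff)
  also have "\<dots> = CARD('a) - 1 + (\<Sum>z\<in>(UNIV :: ('a \<times> 'a) set) - {(0, 0)}. 2)"
    by (subst sum.remove[of _ "(0, 0)"]) auto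
  also have "\<dots> = CARD('a) - 1 + 2 * (CARD('a) ^ 2 - 1)"
    by (simp add: card_Diff_singleton card_cartesian_product power2_eq_square flip: UNIV_Times_UNIV)
  finally show ?thesis .
qed

section \<open>Counting quotients by lines and conics\<close>

text \<open>
  The third coordinates with which \<open>(x, y)\<close> extends to a first factor, when \<open>(p, r, w)\<close> is written
  as a product of two elements of the set.
\<close>
definition fibre :: "'a \<Rightarrow> 'a \<Rightarrow> 'a \<Rightarrow> 'a \<Rightarrow> 'a \<Rightarrow> 'a set" where
  "fibre p r w x y = {u. (x, y, u) \<in> norm_set \<and>
     (x + p, y + r, u + nrm x y + (w + cocycle x y p r)) \<in> norm_set}"

text \<open>
  Generically both factors have two admissible third coordinates, \<open>0\<close> and the norm. Each of the
  four choices is compatible with \<open>(p, r, w)\<close> under one equation for \<open>(x, y)\<close>.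
\<close>
definition hits :: "'a \<Rightarrow> 'a \<Rightarrow> 'a \<Rightarrow> 'a \<Rightarrow> 'a \<Rightarrow> nat" where
  "hits p r w x y = (let t = w + cocycle x y p r; v = nrm x y; v' = nrm (x + p) (y + r) in
     of_bool (t = 0) + of_bool (t = v) + of_bool (t = v') + of_bool (t = v + v'))"

lemma card_quotients:
  "card {h \<in> norm_set. inv\<^bsub>norm_group\<^esub> h \<otimes>\<^bsub>norm_group\<^esub> (p, r, w) \<in> norm_set}
    = (\<Sum>(x, y)\<in>UNIV. card (fibre p r w x y))"
  unfolding fibre_def card_triples[symmetric]
  by (rule arg_cong[where f = card]) (auto simp: inv_norm_group add_ac)

lemma card_fibre:
  assumes "(x, y) \<noteq> (0, 0)" "(x, y) \<noteq> (p, r)"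
  shows "card (fibre p r w x y) = hits p r w x y"
proof -
  define t v v' where "t = w + cocycle x y p r" and "v = nrm x y" and "v' = nrm (x + p) (y + r)"
  have v: "v \<noteq> 0" "v' \<noteq> 0"
    using assms by (auto simp: v_def v'_def eq_iff_add[of x p] eq_iff_add[of y r])
  have "(x + p, y + r) \<noteq> (0, 0)" using assms(2) by (auto simp: eq_iff_add[of x p] eq_iff_add[of y r])
  then have "fibre p r w x y = {u. (u = 0 \<or> u = v) \<and> (u + v + t = 0 \<or> u + v + t = v')}"
    using assms(1) by (auto simp: fibre_def mem_norm_set t_def v_def v'_def)
  also have "\<dots> = {0, v} \<inter> {v + t, v + t + v'}"
    by (auto simp: add_ac) (metis add_self_left add.commute eq_iff_add)+
  also have "card \<dots> = of_bool (0 \<in> {v + t, v + t + v'}) + of_bool (v \<in> {v + t, v + t + v'})"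
    using v(1) by (auto simp: Int_insert_left)
  also have "of_bool (0 \<in> {v + t, v + t + v'}) = (of_bool (t = v) + of_bool (t = v + v') :: nat)"
  proof -
    have "0 = v + t \<longleftrightarrow> t = v" "0 = v + t + v' \<longleftrightarrow> t = v + v'"
      by (rule eq_transfer; simp add: add_ac)+
    then show ?thesis using v(2) by auto
  qed
  also have "of_bool (v \<in> {v + t, v + t + v'}) = (of_bool (t = 0) + of_bool (t = v') :: nat)"
  proof -
    have "v = v + t \<longleftrightarrow> t = 0" "v = v + t + v' \<longleftrightarrow> t = v'"
      by (rule eq_transfer; simp add: add_ac)+
    then show ?thesis using v(2) by auto
  qed
  finally show ?thesis by (simp add: hits_def Let_def flip: t_def v_def v'_def)
qed

text \<open>
  Of the four equations, two are linear, because the quadratic parts cancel, and each has \<open>q\<close>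
  solutions. The other two are translates of norm equations, with \<open>q + 1\<close> solutions each unless the
  right-hand side is zero. That happens precisely when \<open>w\<close> is \<open>0\<close> or the norm of \<open>(p, r)\<close>, that is,
  when \<open>(p, r, w)\<close> belongs to the set.
\<close>
lemma sum_hits:
  assumes "(p, r) \<noteq> (0, 0)"
  shows "(\<Sum>(x, y)\<in>UNIV. hits p r w x y)
    = 2 * CARD('a) + (if w = nrm p r then 1 else CARD('a) + 1) + (if w = 0 then 1 else CARD('a) + 1)"
proof -
  have lines: "(p, p + r) \<noteq> (0, 0)" "(p + r, r) \<noteq> (0, 0)" using assms by auto
  have 1: "w + cocycle x y p r = 0 \<longleftrightarrow> p * x + (p + r) * y = w" for x y
    by (rule eq_transfer) (simp add: cocycle_def algebra_simps)
  have 2: "w + cocycle x y p r = nrm x y \<longleftrightarrow> nrm (x + (p + r)) (y + p) = w + nrm p r" for x y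
    by (rule eq_transfer) (simp add: cocycle_def nrm_def algebra_simps)
  have 3: "w + cocycle x y p r = nrm (x + p) (y + r) \<longleftrightarrow> nrm (x + r) (y + (p + r)) = w" for x y
    by (rule eq_transfer) (simp add: cocycle_def nrm_def algebra_simps)
  have 4: "w + cocycle x y p r = nrm x y + nrm (x + p) (y + r)
      \<longleftrightarrow> (p + r) * x + r * y = w + nrm p r" for x y
    by (rule eq_transfer) (simp add: cocycle_def nrm_def algebra_simps)
  have "(\<Sum>(x, y)\<in>UNIV. hits p r w x y)
      = card {(x, y). p * x + (p + r) * y = w}
      + card {(x, y). nrm (x + (p + r)) (y + p) = w + nrm p r}
      + card {(x, y). nrm (x + r) (y + (p + r)) = w}
      + card {(x, y). (p + r) * x + r * y = w + nrm p r}"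
    by (simp add: hits_def Let_def 1 2 3 4 case_prod_unfold sum.distrib)
  then show ?thesis
    by (simp only: card_line[OF lines(1)] card_line[OF lines(2)] card_nrm_shift
        eq_iff_add[of w "nrm p r"])
qed

text \<open>
  The generic count \<open>hits\<close> is wrong only at \<open>(0, 0)\<close> and \<open>(p, r)\<close>, where one of the two factors is
  central and its third coordinate is an arbitrary nonzero scalar. Correcting these two points turns
  \<open>3q + 2\<close> into \<open>3q\<close> for members of the set and \<open>4q + 2\<close> into \<open>4q + 6\<close> for the others.
\<close>
lemma card_quotients_noncentral:
  assumes "(p, r) \<noteq> (0, 0::'a)"
  shows "card {h \<in> norm_set. inv\<^bsub>norm_group\<^esub> h \<otimes>\<^bsub>norm_group\<^esub> (p, r, w) \<in> norm_set}
    = (if (p, r, w) \<in> norm_set then 3 * CARD('a) else 4 * CARD('a) + 6)"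
proof -
  define n where "n = nrm p r"
  have n: "n \<noteq> 0" using assms by (auto simp: n_def)
  let ?F = "\<lambda>z. card (fibre p r w (fst z) (snd z))" and ?H = "\<lambda>z. hits p r w (fst z) (snd z)"
  let ?Z = "{(0, 0), (p, r)}"
  have split: "sum f UNIV = sum f (UNIV - ?Z) + (f (0, 0) + f (p, r))" for f :: "'a \<times> 'a \<Rightarrow> nat"
    using assms by (subst sum.subset_diff[of ?Z]) auto
  have generic: "sum ?F (UNIV - ?Z) = sum ?H (UNIV - ?Z)"
    by (rule sum.cong) (auto intro!: card_fibre)
  have move: "u + w = 0 \<longleftrightarrow> u = w" "u + w = n \<longleftrightarrow> u = w + n" for u
    by (rule eq_transfer; simp add: add_ac)+
  have wn: "w + n = 0 \<longleftrightarrow> w = n" by (rule eq_iff_add[symmetric])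
  have c0: "cocycle 0 0 p r = 0" by (simp add: cocycle_def)
  have c1: "cocycle p r p r = n" by (simp add: cocycle_def n_def nrm_def algebra_simps)
  have "fibre p r w 0 0 = {w, w + n} - {0}"
    using assms by (auto simp: fibre_def mem_norm_set c0 n_def[symmetric] move)
  then have F0: "?F (0, 0) = (if w = 0 \<or> w = n then 1 else 2)"
    using n wn by (auto simp: insert_Diff_if)
  have "u + n + (w + n) = u + w" for u by (simp add: add_ac)
  then have "fibre p r w p r = {0, n} - {w}"
    using assms by (auto simp: fibre_def mem_norm_set c1 n_def[symmetric] move)
  then have F1: "?F (p, r) = (if w = 0 \<or> w = n then 1 else 2)"
    using n by (auto simp: insert_Diff_if)
  have H: "?H (0, 0) = (if w = 0 \<or> w = n then 2 else 0)"
      "?H (p, r) = (if w = 0 \<or> w = n then 2 else 0)"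
    using n wn by (auto simp: hits_def Let_def c0 c1 n_def[symmetric] add.assoc)
  \<comment> \<open>the correction terms are kept on both sides to avoid truncated subtraction\<close>
  have "sum ?F UNIV + (?H (0, 0) + ?H (p, r)) = sum ?H UNIV + (?F (0, 0) + ?F (p, r))"
    using generic split[of ?F] split[of ?H] by simp
  then show ?thesis
    using sum_hits[OF assms, of w] n assms
    unfolding card_quotients F0 F1 H
    by (auto simp: mem_norm_set case_prod_unfold n_def[symmetric] split: if_splits)
qed

text \<open>
  For a central quotient both factors have the same norm. Two of the four equations become the norm
  equation with right-hand side \<open>w\<close> and the other two have no solution, which gives \<open>2(q + 1)\<close>; two
  central factors give another \<open>q - 2\<close>.
\<close>
lemma card_quotients_central:
  assumes "w \<noteq> (0::'a)"
  shows "card {h \<in> norm_set. inv\<^bsub>norm_group\<^esub> h \<otimes>\<^bsub>norm_group\<^esub> (0, 0, w) \<in> norm_set} = 3 * CARD('a)"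
proof -
  have H: "hits 0 0 w x y = 2 * of_bool (nrm (x + 0) (y + 0) = w)" for x y
    using assms by (auto simp: hits_def cocycle_def)
  have F0: "card (fibre 0 0 w 0 0) = CARD('a) - 2"
  proof -
    have "fibre 0 0 w 0 0 = UNIV - {0, w}"
      using eq_iff_add[of _ w] by (auto simp: fibre_def mem_norm_set cocycle_def)
    then show ?thesis using assms by (simp add: card_Diff_subset)
  qed
  have "(\<Sum>(x, y)\<in>UNIV. card (fibre 0 0 w x y))
      = card (fibre 0 0 w 0 0) + (\<Sum>(x, y)\<in>UNIV - {(0, 0)}. card (fibre 0 0 w x y))"
    by (subst sum.remove[of _ "(0, 0)"]) auto
  also have "(\<Sum>(x, y)\<in>UNIV - {(0, 0)}. card (fibre 0 0 w x y))
      = (\<Sum>(x, y)\<in>UNIV - {(0, 0)}. hits 0 0 w x y)"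
    by (rule sum.cong) (auto intro!: card_fibre)
  also have "\<dots> = (\<Sum>(x, y)\<in>UNIV. hits 0 0 w x y)"
    using assms by (subst (2) sum.remove[of _ "(0, 0)"]) (auto simp: H)
  also have "\<dots> = 2 * card {(x, y). nrm (x + 0) (y + 0) = w}"
    unfolding H by (simp add: case_prod_unfold sum_distrib_left[symmetric])
  also have "\<dots> = 2 * (CARD('a) + 1)" unfolding card_nrm_shift using assms by simp
  finally show ?thesis unfolding card_quotients F0 using card_ge_2 by simp
qed

theorem partial_difference_set_norm_set:
  "partial_difference_set (norm_group :: ('a \<times> 'a \<times> 'a) monoid)
     (CARD('a) ^ 3) (CARD('a) - 1 + 2 * (CARD('a) ^ 2 - 1)) (3 * CARD('a)) (4 * CARD('a) + 6) norm_set"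
  unfolding partial_difference_set_iff
proof (intro conjI ballI)
  fix g :: "'a \<times> 'a \<times> 'a" assume g: "g \<in> carrier norm_group - {\<one>\<^bsub>norm_group\<^esub>}"
  obtain p r w where prw: "g = (p, r, w)" by (metis prod_cases3)
  show "card {x \<in> norm_set. inv\<^bsub>norm_group\<^esub> x \<otimes>\<^bsub>norm_group\<^esub> g \<in> norm_set} =
      (if g \<in> norm_set then 3 * CARD('a) else 4 * CARD('a) + 6)"
  proof (cases "(p, r) = (0, 0)")
    case True
    then show ?thesis using g card_quotients_central[of w] by (simp add: prw mem_norm_set)
  next
    case False
    then show ?thesis unfolding prw by (rule card_quotients_noncentral)
  qed
next
  fix s :: "'a \<times> 'a \<times> 'a" assume "s \<in> norm_set"
  then show "inv\<^bsub>norm_group\<^esub> s \<in> norm_set"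
    by (cases s) (auto simp: inv_norm_group mem_norm_set)
qed (simp_all add: group_norm_group order_norm_group card_norm_set mem_norm_set)

end

section \<open>Twisting by the field automorphism\<close>

text \<open>
  The field automorphism sends \<open>(a, b)\<close> to the conjugate pair. It is attached to the
  elements whose middle coordinate is outside the kernel of \<open>l\<close>; the middle coordinate is used
  because it is both additive and fixed by the automorphism.
\<close>
definition half_conj :: "('a::field \<Rightarrow> bit) \<Rightarrow> 'a \<times> 'a \<times> 'a \<Rightarrow> 'a \<times> 'a \<times> 'a \<Rightarrow> 'a \<times> 'a \<times> 'a" where
  "half_conj l = (\<lambda>(x, y, u) (x', y', u').
     if l y = 0 then (x', y', u') else (x' + y', y', u' + nrm x' y'))"

lemma half_conj_simp [simp]:
  "half_conj l (x, y, u) (x', y', u') =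
     (if l y = 0 then (x', y', u') else (x' + y', y', u' + nrm x' y'))"
  by (simp add: half_conj_def)

context anisotropic_char2
begin

lemma nrm_conj: "nrm (x + y) y = nrm x (y::'a)"
  by (simp add: nrm_def algebra_simps)

lemma half_conj_iso: "half_conj l g \<in> iso norm_group (norm_group :: ('a \<times> 'a \<times> 'a) monoid)"
proof -
  have involution: "half_conj l g (half_conj l g h) = h" for h
    by (cases g; cases h) (simp add: nrm_conj add.assoc)
  have "bij (half_conj l g)"
    by (rule bij_betw_byWitness[where f' = "half_conj l g"]) (auto simp: involution)
  moreover have "half_conj l g (h \<otimes>\<^bsub>norm_group\<^esub> k) = half_conj l g h \<otimes>\<^bsub>norm_group\<^esub> half_conj l g k" for h k
    by (cases g; cases h; cases k) (simp add: cocycle_def nrm_def algebra_simps)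
  ultimately show ?thesis by (simp add: iso_def hom_def del: norm_group_simps(2))
qed

lemma twisting_half_conj:
  assumes l: "\<And>x y::'a. l (x + y) = l x + l y"
  shows "twisting (norm_group :: ('a \<times> 'a \<times> 'a) monoid) (half_conj l)"
proof (intro twisting.intro twisting_axioms.intro group_norm_group half_conj_iso)
  fix g h k :: "'a \<times> 'a \<times> 'a"
  show "half_conj l (g \<otimes>\<^bsub>norm_group\<^esub> half_conj l g h) k = half_conj l g (half_conj l h k)"
    by (cases g; cases h; cases k) (simp add: l nrm_conj add.assoc)
qed

lemma partial_difference_set_half_conj:
  assumes l: "\<And>x y::'a. l (x + y) = l x + l y"
  shows "partial_difference_set (twist (norm_group :: ('a \<times> 'a \<times> 'a) monoid) (half_conj l))
     (CARD('a) ^ 3) (CARD('a) - 1 + 2 * (CARD('a) ^ 2 - 1)) (3 * CARD('a)) (4 * CARD('a) + 6) norm_set"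
proof (rule twisting.partial_difference_set_twist[OF twisting_half_conj[OF l] partial_difference_set_norm_set])
  fix g h :: "'a \<times> 'a \<times> 'a"
  obtain x y u x' y' u' where gh: "g = (x, y, u)" "h = (x', y', u')" by (metis prod_cases3)
  have "u' + nrm x' y' = 0 \<longleftrightarrow> u' = nrm x' y'" by (rule eq_iff_add[symmetric])
  then show "half_conj l g h \<in> norm_set \<longleftrightarrow> h \<in> norm_set"
    by (auto simp: gh mem_norm_set nrm_conj)
qed

lemma not_comm_norm_group: "\<not> comm_group (norm_group :: ('a \<times> 'a \<times> 'a) monoid)"
proof
  assume "comm_group (norm_group :: ('a \<times> 'a \<times> 'a) monoid)"
  then interpret comm_group "norm_group :: ('a \<times> 'a \<times> 'a) monoid" .
  show False using m_comm[of "(1, 0, 0)" "(0, 1, 0)"] by (simp add: cocycle_def)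
qed

lemma not_comm_half_conj:
  assumes "l 0 = 0" "l y = 0" "y \<noteq> (0::'a)"
  shows "\<not> comm_group (twist (norm_group :: ('a \<times> 'a \<times> 'a) monoid) (half_conj l))"
proof
  assume "comm_group (twist (norm_group :: ('a \<times> 'a \<times> 'a) monoid) (half_conj l))"
  then interpret comm_group "twist (norm_group :: ('a \<times> 'a \<times> 'a) monoid) (half_conj l)" .
  show False using m_comm[of "(1, 0, 0)" "(0, y, 0)"] assms by (simp add: cocycle_def)
qed

text \<open>
  In the original group squares are central and of order at most two, so all fourth powers are
  trivial. In the twist, an element on which \<open>l\<close> is nonzero has a square that is noncentral in the
  original group, and hence a nontrivial fourth power.
\<close>
lemma half_conj_not_iso:
  assumes l: "l 0 = 0" "l y = 1" and y: "y \<noteq> (0::'a)"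
  shows "\<not> (norm_group :: ('a \<times> 'a \<times> 'a) monoid) \<cong> twist (norm_group :: ('a \<times> 'a \<times> 'a) monoid) (half_conj l)"
    (is "\<not> ?G \<cong> ?H")
proof
  assume "?G \<cong> ?H"
  then obtain f where "f \<in> iso ?G ?H" by (auto simp: is_iso_def)
  then have f: "f \<in> hom ?G ?H" "surj f" by (auto simp: iso_def bij_betw_def)
  have hom: "f (g \<otimes>\<^bsub>?G\<^esub> h) = f g \<otimes>\<^bsub>?H\<^esub> f h" for g h
    using hom_mult[OF f(1), of g h] by (simp only: norm_group_simps(1) UNIV_I)
  then obtain g where g: "f g = (0, y, 0)" using f(2) by (metis surjD)
  have one: "f (0, 0, 0) \<otimes>\<^bsub>?H\<^esub> f (0, 0, 0) = f (0, 0, 0)"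
    using hom[of "(0, 0, 0)" "(0, 0, 0)"] by (simp add: cocycle_def)
  have "(g \<otimes>\<^bsub>?G\<^esub> g) \<otimes>\<^bsub>?G\<^esub> (g \<otimes>\<^bsub>?G\<^esub> g) = (0, 0, 0)"
    by (cases g) (simp add: cocycle_def)
  then have "f (0, 0, 0) = (f g \<otimes>\<^bsub>?H\<^esub> f g) \<otimes>\<^bsub>?H\<^esub> (f g \<otimes>\<^bsub>?H\<^esub> f g)"
    by (metis hom)
  also have "\<dots> = (0, 0, y * y)" using l by (simp add: g cocycle_def)
  finally have "f (0, 0, 0) = (0, 0, y * y)" .
  then show False using one l y by (simp add: cocycle_def)
qed

end

section \<open>Copies on natural numbers\<close>

lemma ex_nat_copy:
  assumes "group G" "finite (carrier G)"
  shows "\<exists>G' :: nat monoid. group G' \<and> G \<cong> G'"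
proof -
  obtain f :: "'a \<Rightarrow> nat" where f: "inj_on f (carrier G)"
    using finite_imp_inj_to_nat_seg[OF assms(2)] by blast
  have "group (image_group f G)" using group.inj_imp_image_group_is_group[OF assms(1) f] .
  moreover have "G \<cong> image_group f G" using inj_imp_image_group_iso[OF f] by (rule is_isoI)
  ultimately show ?thesis by blast
qed

lemma partial_difference_set_is_iso:
  assumes "partial_difference_set G v k l m S" "group H" "G \<cong> H"
  shows "\<exists>T. partial_difference_set H v k l m T"
  using assms partial_difference_set_iso unfolding is_iso_def by blast

section \<open>The field with eight elements\<close>

text \<open>
  The residues \<open>c\<^sub>0 + c\<^sub>1 t + c\<^sub>2 t\<^sup>2\<close> of binary polynomials modulo \<open>t\<^sup>3 + t + 1\<close>.
\<close>
datatype gf8 = GF8 (c0: bit) (c1: bit) (c2: bit)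

instantiation gf8 :: field
begin
definition "0 = GF8 0 0 0"
definition "1 = GF8 1 0 0"
definition "x + y = GF8 (c0 x + c0 y) (c1 x + c1 y) (c2 x + c2 y)"
definition "- x = (x :: gf8)"
definition "x - y = x + (y :: gf8)"
definition "x * y = GF8
  (c0 x * c0 y + c1 x * c2 y + c2 x * c1 y)
  (c0 x * c1 y + c1 x * c0 y + c1 x * c2 y + c2 x * c1 y + c2 x * c2 y)
  (c0 x * c2 y + c1 x * c1 y + c2 x * c0 y + c2 x * c2 y)"
\<comment> \<open>the sixth power, as the multiplicative group has order seven\<close>
definition "inverse x = (x * x) * ((x * x) * (x * x) :: gf8)"
definition "x div y = x * inverse (y :: gf8)"
instance
proof
  fix x y z :: gf8
  have bit2: "b + b = 0" "b + (b + c) = c" for b c :: bit by (cases b; cases c; simp)+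
  show "x * y * z = x * (y * z)"
    by (cases x; cases y; cases z)
      (simp add: times_gf8_def algebra_simps bit2 del: add_bit_eq_xor mult_bit_eq_and)
  show "(x + y) * z = x * z + y * z"
    by (simp add: times_gf8_def plus_gf8_def algebra_simps del: add_bit_eq_xor mult_bit_eq_and)
  show "x \<noteq> 0 \<Longrightarrow> inverse x * x = 1"
    by (cases x; cases "c0 x"; cases "c1 x"; cases "c2 x")
      (simp_all add: times_gf8_def inverse_gf8_def zero_gf8_def one_gf8_def)
qed (auto simp: zero_gf8_def one_gf8_def plus_gf8_def times_gf8_def uminus_gf8_def minus_gf8_def
    divide_gf8_def inverse_gf8_def algebra_simps simp del: add_bit_eq_xor mult_bit_eq_and)
end

lemma UNIV_gf8: "(UNIV :: gf8 set) = (\<lambda>(a, b, c). GF8 a b c) ` UNIV"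
  by (auto simp: image_iff) (metis gf8.exhaust)

instance gf8 :: finite
proof
  have "finite (UNIV :: bit set)" by (rule finite_subset[of _ "{0,1}"]) auto
  thus "finite (UNIV :: gf8 set)" unfolding UNIV_gf8 by (simp flip: UNIV_Times_UNIV)
qed

lemma CARD_gf8: "CARD(gf8) = 8"
proof -
  have "CARD(bit) = card {0, 1::bit}" by (rule arg_cong[where f = card]) auto
  then have "CARD(bit) = 2" by simp
  moreover have "inj (\<lambda>(a, b, c). GF8 a b c)" by (auto simp: inj_def)
  ultimately show ?thesis
    by (simp add: UNIV_gf8 card_image card_cartesian_product flip: UNIV_Times_UNIV)
qed

interpretation gf8: anisotropic_char2 "TYPE(gf8)"
proof
  show "(1::gf8) + 1 = 0" by (simp add: one_gf8_def zero_gf8_def plus_gf8_def)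
  show "x * x + x + 1 \<noteq> 0" for x :: gf8
    by (cases x; cases "c0 x"; cases "c1 x"; cases "c2 x")
      (simp_all add: one_gf8_def zero_gf8_def plus_gf8_def times_gf8_def)
qed

section \<open>Two groups of order 512\<close>

theorem theorem5p9:
  shows "\<exists>(G :: nat monoid) (H :: nat monoid).
    group G \<and> order G = 512 \<and> \<not> comm_group G \<and>
    group H \<and> order H = 512 \<and> \<not> comm_group H \<and>
    \<not> G \<cong> H \<and>
    (\<exists>S. partial_difference_set G 512 133 24 38 S) \<and>
    (\<exists>T. partial_difference_set H 512 133 24 38 T)"
proof -
  define P where "P = (norm_group :: (gf8 \<times> gf8 \<times> gf8) monoid)"
  define Q where "Q = twist P (half_conj c2)"
  \<comment> \<open>the twisting functional is the coefficient of \<open>t\<^sup>2\<close>, so \<open>1\<close> lies in its kernel and \<open>t\<^sup>2\<close> does not\<close>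
  have c2: "c2 (x + y) = c2 x + c2 y" "c2 0 = 0" "c2 1 = 0" "c2 (GF8 0 0 1) = 1" for x y
    by (simp_all add: plus_gf8_def zero_gf8_def one_gf8_def)
  have pds: "partial_difference_set P 512 133 24 38 norm_set"
      "partial_difference_set Q 512 133 24 38 norm_set"
    using gf8.partial_difference_set_norm_set gf8.partial_difference_set_half_conj[OF c2(1)]
    by (simp_all add: P_def Q_def CARD_gf8)
  then have groups: "group P" "group Q" "finite (carrier P)" "finite (carrier Q)"
    by (simp_all add: partial_difference_set_iff)
  have nonabelian: "\<not> comm_group P" "\<not> comm_group Q"
    using gf8.not_comm_norm_group gf8.not_comm_half_conj[OF c2(2,3)] by (simp_all add: P_def Q_def)
  have "GF8 0 0 1 \<noteq> 0" by (simp add: zero_gf8_def)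
  then have PQ: "\<not> P \<cong> Q"
    using gf8.half_conj_not_iso[OF c2(2,4)] by (simp add: P_def Q_def)
  obtain G H :: "nat monoid" where GH: "group G" "P \<cong> G" "group H" "Q \<cong> H"
    using ex_nat_copy groups by metis
  obtain S T where ST: "partial_difference_set G 512 133 24 38 S"
      "partial_difference_set H 512 133 24 38 T"
    using partial_difference_set_is_iso[OF pds(1) GH(1,2)]
      partial_difference_set_is_iso[OF pds(2) GH(3,4)] by blast
  have iso: "G \<cong> P" "H \<cong> Q"
    using group.iso_sym[OF groups(1) GH(2)] group.iso_sym[OF groups(2) GH(4)] .
  have "\<not> comm_group G" "\<not> comm_group H"
    using comm_group.iso_imp_comm_group[OF _ iso(1)] comm_group.iso_imp_comm_group[OF _ iso(2)]
      groups(1,2)[THEN group.is_monoid] nonabelian by blast+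
  moreover have "\<not> G \<cong> H"
    using PQ iso_trans[OF iso_trans[OF GH(2)] iso(2)] by blast
  moreover have "order G = 512" "order H = 512"
    using ST by (simp_all add: partial_difference_set_iff)
  ultimately show ?thesis using GH(1,3) ST by blast
qed

end
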